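(* Let $f:\mathbb{C}\to\mathbb{C}$ be a transcendental entire function, let $D$ be an open disc meeting $J(f)$, and suppose that there exists a bounded domain $U\subset\mathbb{C}$ with $\partial U\subset B_D(f)$ and $U\cap J(f)\neq\emptyset$. Then: (a) the sets $\beta_n=f^n(\partial U)$ satisfy $\beta_n\to\infty$ as $n\to\infty$ and, for all sufficiently large $n$, $\beta_n\subset B_D(f)$ and $\beta_n$ surrounds $0$; (b) $B_D(f)$, $B(f)$ and $I(f)$ are all connected.
   Context: $\mathbb{N}=\{1,2,3,\dots\}$ and $f^n$ denotes the $n$th iterate of $f$. The Fatou set $F(f)$ is the set of $z\in\mathbb{C}$ such that $(f^n)_{n\in\mathbb{N}}$ is a normal family in some neighbourhood of $z$; the Julia set is $J(f)=\mathbb{C}\setminus F(f)$. The escaping set is $I(f)=\{z\in\mathbb{C}: f^n(z)\to\infty \text{ as } n\to\infty\}$. A domain is a non-empty connected open set. For a bounded domain $G$, $\widetilde{G}$ denotes the union of $G$ and the bounded components of $\mathbb{C}\setminus G$. For an open disc $D$ meeting $J(f)$, $B_D(f)=\{z\in\mathbb{C}: f^n(z)\notin\widetilde{f^n(D)} \text{ for all } n\in\mathbb{N}\}$ and $B(f)=\{z\in\mathbb{C}: \text{there exists } L\in\mathbb{N} \text{ such that } f^{n+L}(z)\notin\widetilde{f^n(D)} \text{ for all } n\in\mathbb{N}\}$; the set $B(f)$ does not depend on the choice of the open disc $D$ meeting $J(f)$. For compact sets $\beta_n$, $\beta_n\to\infty$ means $\min_{z\in\beta_n}|z|\to\infty$.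 A compact set $\beta$ surrounds a point (or a connected set) if that point (or set) lies in a bounded component of $\mathbb{C}\setminus\beta$. *)

theory Defs
  imports "HOL-Complex_Analysis.Complex_Analysis"
begin

definition transcendental_entire :: "(complex \<Rightarrow> complex) \<Rightarrow> bool" where
  "transcendental_entire f \<longleftrightarrow>
     f holomorphic_on UNIV \<and> \<not> (\<exists>p :: complex poly. f = poly p)"

definition plane_domain :: "complex set \<Rightarrow> bool" where
  "plane_domain U \<longleftrightarrow> open U \<and> connected U \<and> U \<noteq> {}"

text \<open>Normality, for families of holomorphic functions on a domain, is meant with respect to
  the spherical metric: the locally uniform limit of a subsequence is either holomorphic or the
  constant \<open>\<infinity>\<close> (mixed limits cannot occur because the domain is connected).\<close>

definition normal_family_on :: "(complex \<Rightarrow> complex) set \<Rightarrow> complex set \<Rightarrow> bool" where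
  "normal_family_on \<F> V \<longleftrightarrow>
     (\<forall>s :: nat \<Rightarrow> complex \<Rightarrow> complex. range s \<subseteq> \<F> \<longrightarrow>
        (\<exists>r :: nat \<Rightarrow> nat. strict_mono r \<and>
           ((\<exists>g. g holomorphic_on V \<and>
               (\<forall>K. compact K \<and> K \<subseteq> V \<longrightarrow> uniform_limit K (\<lambda>n. s (r n)) g sequentially)) \<or>
            (\<forall>K. compact K \<and> K \<subseteq> V \<longrightarrow>
               (\<forall>M :: real. \<forall>\<^sub>F n in sequentially. \<forall>z\<in>K. M < norm (s (r n) z))))))"

definition fatou_set :: "(complex \<Rightarrow> complex) \<Rightarrow> complex set" where
  "fatou_set f = {z. \<exists>V. plane_domain V \<and> z \<in> V \<and> normal_family_on {f ^^ n | n. n \<ge> 1} V}"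

definition julia_set :: "(complex \<Rightarrow> complex) \<Rightarrow> complex set" where
  "julia_set f = - fatou_set f"

definition escaping_set :: "(complex \<Rightarrow> complex) \<Rightarrow> complex set" where
  "escaping_set f = {z. filterlim (\<lambda>n. (f ^^ n) z) at_infinity sequentially}"

text \<open>\<^const>\<open>inside\<close> \<open>G\<close> is the union of the bounded components of the complement of \<open>G\<close>.\<close>

definition fill :: "complex set \<Rightarrow> complex set" where
  "fill G = G \<union> inside G"

definition disc_meeting_julia :: "(complex \<Rightarrow> complex) \<Rightarrow> complex set \<Rightarrow> bool" where
  "disc_meeting_julia f D \<longleftrightarrow> (\<exists>c r. r > 0 \<and> D = ball c r) \<and> D \<inter> julia_set f \<noteq> {}"

definition B_disc :: "(complex \<Rightarrow> complex) \<Rightarrow> complex set \<Rightarrow> complex set" where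
  "B_disc f D = {z. \<forall>n\<ge>1. (f ^^ n) z \<notin> fill ((f ^^ n) ` D)}"

text \<open>The set \<open>B(f)\<close>, computed from the disc \<open>D\<close>. For transcendental entire \<open>f\<close> it is the same
  for all discs meeting the Julia set, so assertions about \<open>B(f)\<close> are stated for every such disc.\<close>

definition B_set :: "(complex \<Rightarrow> complex) \<Rightarrow> complex set \<Rightarrow> complex set" where
  "B_set f D = {z. \<exists>L\<ge>1. \<forall>n\<ge>1. (f ^^ (n + L)) z \<notin> fill ((f ^^ n) ` D)}"

text \<open>For non-empty compact sets the infimum is the minimum of the modulus.\<close>

definition sets_tend_to_infinity :: "(nat \<Rightarrow> complex set) \<Rightarrow> bool" where
  "sets_tend_to_infinity \<beta> \<longleftrightarrow> filterlim (\<lambda>n. INF z\<in>\<beta> n. norm z) at_top sequentially"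

definition surrounds :: "complex set \<Rightarrow> complex \<Rightarrow> bool" where
  "surrounds \<beta> z \<longleftrightarrow> z \<in> inside \<beta>"

end

theory Submission imports Defs begin

text \<open>Write \<open>D\<^sub>n\<close> for \<open>fill ((f ^^ n) ` D)\<close>. Two facts drive the proof. First, \<open>D\<^sub>n\<close> eventually
  contains any given disc: otherwise, for a large radius \<open>R\<close>, no \<open>D\<^sub>n\<close> would contain \<open>ball 0 R\<close>, so
  every iterate would omit on \<open>D\<close> a value on each circle of radius at least \<open>R\<close>, and the iterates
  would be normal on \<open>D\<close> by Montel's theorem. (Once \<open>ball 0 R\<close> lies in some \<open>D\<^sub>n\<close> it lies in all later
  ones, as \<open>ball 0 R \<subseteq> fill (f ` ball 0 R)\<close> for large \<open>R\<close>.) This gives (a). Second, \<open>B_disc f D\<close> is a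
  decreasing intersection of preimages, under iterates, of unbounded connected closed sets, and the
  components of such preimages are unbounded; so each of its points lies in a connected subset
  that reaches any prescribed large circle and hence crosses every far-out \<open>\<beta>\<^sub>n\<close>. The same applies to
  \<open>B_set f E\<close>. For \<open>escaping_set f\<close>, a point outside the closure of \<open>B_set f D\<close> lies in a component
  \<open>V\<close> of the complement whose images never cross any far-out \<open>\<beta>\<^sub>n\<close>, so that even \<open>closure V\<close> escapes.\<close>

section \<open>Filled sets and preimages under open maps\<close>

lemma fill_eq_outside: "fill G = - outside G"
  by (simp add: fill_def union_with_inside)

lemma subset_fill: "G \<subseteq> fill G"
  by (simp add: fill_def)

lemma fill_mono: "G \<subseteq> H \<Longrightarrow> fill G \<subseteq> fill H"
  by (simp add: fill_eq_outside outside_mono)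

lemma unbounded_connected_imp_outside:
  assumes "connected \<Gamma>" "\<not> bounded \<Gamma>" "\<Gamma> \<inter> G = {}"
  shows "\<Gamma> \<subseteq> outside G"
proof
  fix x assume "x \<in> \<Gamma>"
  then have "\<Gamma> \<subseteq> connected_component_set (- G) x"
    using assms by (intro connected_component_maximal) auto
  then show "x \<in> outside G"
    using assms(2) by (auto simp: outside dest: bounded_subset)
qed

text \<open>As \<open>G\<close> is bounded, \<open>outside G\<close> is connected and unbounded. It
  misses \<open>H\<close>, so it lies in \<open>outside H\<close>; complements give the
  claim.\<close>

lemma fill_subset:
  fixes G H :: "complex set"
  assumes "bounded G" "H \<subseteq> fill G"
  shows "fill H \<subseteq> fill G"
proof -
  have "outside G \<subseteq> outside H"
    using assms unbounded_outside[of G] connected_outside[of G]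
    by (intro unbounded_connected_imp_outside) (auto simp: fill_eq_outside)
  then show ?thesis
    by (auto simp: fill_eq_outside)
qed

lemma closed_outside_open:
  fixes G :: "complex set"
  assumes "open G" "bounded G"
  shows "closed (outside G)"
proof -
  have "outside G \<noteq> {}"
    using unbounded_outside[OF assms(2)] by auto
  then have "outside G \<in> components (- G)"
    by (simp add: outside_in_components connected_outside assms)
  then show ?thesis
    using assms(1) closed_components by blast
qed

text \<open>The norm maps the connected unbounded set \<open>outside S\<close> onto an interval
  unbounded above. This supplies omitted values of prescribed modulus.\<close>

lemma outside_meets_sphere:
  assumes "bounded S" "w \<in> outside S" "norm w \<le> r"
  obtains a :: complex where "a \<in> outside S" "norm a = r"
proof -
  obtain y where y: "y \<in> outside S" "r < norm y"
    using unbounded_outside[OF assms(1)] by (auto simp: bounded_iff not_le)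
  have "connected (norm ` outside S)"
    using connected_outside[OF assms(1)]
    by (intro connected_continuous_image continuous_on_norm_id) auto
  then have "r \<in> norm ` outside S"
    using assms y connectedD_interval[of "norm ` outside S" "norm w" "norm y" r] by auto
  then show ?thesis using that by auto
qed

text \<open>If the component failed to reach the sphere, then by the theorem of Sura-Bura it would be
  contained in a compact relatively open part of \<open>g -` E\<close>, whose image would be open and closed in
  \<open>E\<close> and hence all of \<open>E\<close>.\<close>

lemma preimage_component_meets_sphere:
  fixes g :: "complex \<Rightarrow> complex"
  assumes cont: "continuous_on UNIV g" and op: "\<And>S. open S \<Longrightarrow> open (g ` S)"
    and E: "closed E" "connected E" "\<not> bounded E"
    and z: "g z \<in> E" "norm z \<le> R"
  shows "connected_component_set (g -` E \<inter> cball 0 R) z \<inter> sphere 0 R \<noteq> {}"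
proof
  define S where "S = g -` E \<inter> cball 0 R"
  define C where "C = connected_component_set S z"
  assume "connected_component_set (g -` E \<inter> cball 0 R) z \<inter> sphere 0 R = {}"
  then have disj: "C \<inter> sphere 0 R = {}"
    by (simp add: C_def S_def)
  have "closed (g -` E)"
    using cont E(1) by (simp add: continuous_on_closed_vimage)
  then have "compact S"
    by (auto simp: S_def closed_Int_compact)
  have "z \<in> S"
    using z by (simp add: S_def)
  then have C: "C \<in> components S" "z \<in> C"
    by (auto simp: C_def components_def connected_component_refl)
  then have "compact C" "C \<subseteq> S"
    using \<open>compact S\<close> compact_components in_components_subset by blast+
  then have "C \<subseteq> ball 0 R"
    using disj by (force simp: S_def less_le)
  then obtain K where K: "openin (top_of_set S) K" "compact K" "C \<subseteq> K" "K \<subseteq> ball 0 R"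
    using Sura_Bura_clopen_subset[of S C "ball 0 R"] C(1) \<open>compact C\<close> \<open>compact S\<close>
      compact_imp_closed closed_imp_locally_compact by blast
  then obtain N where N: "open N" "K = S \<inter> N"
    by (auto simp: openin_open)
  have "g ` K = E \<inter> g ` (N \<inter> ball 0 R)"
    using N(2) K(4) by (auto simp: S_def)
  then have "openin (top_of_set E) (g ` K)"
    using op[of "N \<inter> ball 0 R"] N(1) by (auto simp: openin_open)
  moreover have "compact (g ` K)"
    using K(2) cont by (meson compact_continuous_image continuous_on_subset subset_UNIV)
  moreover have "g ` K \<subseteq> E"
    using \<open>g ` K = E \<inter> _\<close> by blast
  ultimately have "g ` K = {} \<or> g ` K = E"
    using E(2) by (metis connected_clopen closed_subset compact_imp_closed)
  then show False
    using C(2) K(3) E(3) \<open>compact (g ` K)\<close> compact_imp_bounded by auto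
qed

section \<open>Images of filled sets under open maps\<close>

lemma bounded_continuous_image:
  fixes g :: "complex \<Rightarrow> complex"
  assumes "continuous_on UNIV g" "bounded G"
  shows "bounded (g ` G)"
proof -
  have "compact (g ` closure G)"
    using assms by (meson compact_closure compact_continuous_image continuous_on_subset subset_UNIV)
  then show ?thesis
    by (meson bounded_subset closure_subset compact_imp_bounded image_mono)
qed

lemma image_fill_subset:
  fixes g :: "complex \<Rightarrow> complex"
  assumes cont: "continuous_on UNIV g" and op: "\<And>S. open S \<Longrightarrow> open (g ` S)"
    and G: "open G" "bounded G"
  shows "g ` fill G \<subseteq> fill (g ` G)"
proof
  fix w assume "w \<in> g ` fill G"
  then obtain z where z: "z \<in> fill G" "w = g z" by auto
  define E where "E = outside (g ` G)"
  have bd: "bounded (g ` G)"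
    using cont G(2) by (rule bounded_continuous_image)
  have E: "closed E" "connected E" "\<not> bounded E"
    using bd op[OF G(1)] by (auto simp: E_def closed_outside_open connected_outside unbounded_outside)
  have disj: "E \<inter> g ` G = {}"
    by (simp add: E_def)
  show "w \<in> fill (g ` G)"
  proof (rule ccontr)
    assume "w \<notin> fill (g ` G)"
    then have "g z \<in> E"
      using z by (simp add: fill_eq_outside E_def)
    have "\<exists>y. B \<le> norm y \<and> connected_component (- G) z y" for B
    proof -
      define R where "R = max B (norm z)"
      obtain y where y: "connected_component (g -` E \<inter> cball 0 R) z y" "norm y = R"
        using preimage_component_meets_sphere[OF cont op E \<open>g z \<in> E\<close>, of R] by (auto simp: R_def)
      have "g -` E \<inter> cball 0 R \<subseteq> - G"
        using disj by auto
      then have "connected_component (- G) z y"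
        using y(1) connected_component_of_subset by blast
      then show ?thesis
        using y(2) by (metis R_def max.cobounded1)
    qed
    then have "z \<in> outside G"
      by (auto simp: outside_connected_component_le)
    then show False
      using z(1) by (simp add: fill_eq_outside)
  qed
qed

text \<open>The components through \<open>z\<close> form a decreasing sequence of continua. Their
  intersection is connected, and by compactness it still meets the sphere.\<close>

lemma nested_components_meet_sphere:
  fixes X :: "nat \<Rightarrow> complex set"
  assumes "\<And>n. closed (X n)" "decseq X"
    and meets: "\<And>n. connected_component_set (X n \<inter> cball 0 R) z \<inter> sphere 0 R \<noteq> {}"
  obtains C where "connected C" "z \<in> C" "C \<subseteq> (\<Inter>n. X n)" "C \<inter> sphere 0 R \<noteq> {}"
proof -
  define K where "K n = connected_component_set (X n \<inter> cball 0 R) z" for n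
  have K: "compact (K n)" "connected (K n)" "K n \<subseteq> X n" "z \<in> K n" for n
  proof -
    have "compact (X n \<inter> cball 0 R)"
      using assms(1) by (simp add: closed_Int_compact)
    moreover have z: "z \<in> X n \<inter> cball 0 R"
      using meets[of n] connected_component_eq_empty[of "X n \<inter> cball 0 R" z] by auto
    ultimately show "compact (K n)"
      unfolding K_def by (metis compact_components componentsI)
    show "connected (K n)" "K n \<subseteq> X n" "z \<in> K n"
      using z connected_component_subset[of "X n \<inter> cball 0 R" z]
      by (auto simp: K_def connected_component_refl)
  qed
  have nest: "K n \<subseteq> K m" if "m \<le> n" for m n
    unfolding K_def using decseqD[OF assms(2) that] by (intro connected_component_mono) auto
  show ?thesis
  proof
    show "connected (\<Inter> (range K))"
      using K nest by (intro connected_nest)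
    have "\<Inter> (range (\<lambda>n. K n \<inter> sphere 0 R)) \<noteq> {}"
    proof (rule compact_nest)
      show "compact (K n \<inter> sphere 0 R)" for n
        using K(1) by (simp add: compact_Int_closed)
      show "K n \<inter> sphere 0 R \<noteq> {}" for n
        using meets by (simp add: K_def)
      show "K n \<inter> sphere 0 R \<subseteq> K m \<inter> sphere 0 R" if "m \<le> n" for m n
        using nest[OF that] by auto
    qed
    then show "\<Inter> (range K) \<inter> sphere 0 R \<noteq> {}"
      by auto
  qed (use K in blast)+
qed

text \<open>Avoiding \<open>\<beta>\<close>, the set \<open>C\<close> would join a point inside
  \<open>\<beta>\<close> to a point of the sphere, which is outside.\<close>

lemma connected_meets_surrounding:
  assumes "connected C" "z \<in> C" "z \<in> inside \<beta>" "\<beta> \<subseteq> ball 0 R" "C \<inter> sphere 0 R \<noteq> {}"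
  shows "C \<inter> \<beta> \<noteq> ({} :: complex set)"
proof
  assume "C \<inter> \<beta> = {}"
  obtain y where y: "y \<in> C" "norm y = R"
    using assms(5) by force
  have "connected_component (- \<beta>) z y"
    using assms(1,2) y(1) \<open>C \<inter> \<beta> = {}\<close> by (auto simp: connected_component_def)
  then have "y \<in> inside \<beta>"
    using assms(3) inside_same_component by blast
  moreover have "y \<in> outside \<beta>"
    using outside_subset_convex[OF convex_ball assms(4)] y(2) by auto
  ultimately show False
    using inside_Int_outside by blast
qed

section \<open>Growth and normality\<close>

text \<open>Cauchy's estimates along a sequence of radii tending to infinity kill all Taylor
  coefficients of order at least 2.\<close>

lemma affine_growth_imp_polynomial:
  assumes holf: "f holomorphic_on UNIV"
    and growth: "\<And>r0. \<exists>r\<ge>r0. \<forall>w. norm w \<le> r \<longrightarrow> norm (f w) \<le> C * r"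
  shows "\<exists>p. f = poly p"
proof -
  have zero: "(deriv ^^ n) f 0 = 0" if "n \<ge> 2" for n
  proof (rule ccontr)
    assume nz: "(deriv ^^ n) f 0 \<noteq> 0"
    define d where "d = norm ((deriv ^^ n) f 0)"
    have "d > 0" using nz by (simp add: d_def)
    \<comment> \<open>The radius is so large that \<open>d * r\<close> exceeds
      \<open>fact n * \<bar>C\<bar>\<close>, contradicting the Cauchy estimate below.\<close>
    obtain r where r: "r \<ge> max 1 ((fact n * \<bar>C\<bar> + 1) / d)"
        "\<And>w. norm w \<le> r \<Longrightarrow> norm (f w) \<le> C * r"
      using growth by blast
    then have "r \<ge> 1" "fact n * \<bar>C\<bar> + 1 \<le> d * r"
      using \<open>d > 0\<close> by (auto simp: field_simps)
    have "d \<le> fact n * (C * r) / r ^ n"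
      unfolding d_def
    proof (rule Cauchy_inequality)
      show "f holomorphic_on ball 0 r"
        using holf holomorphic_on_subset by blast
      show "continuous_on (cball 0 r) f"
        using holf holomorphic_on_imp_continuous_on holomorphic_on_subset by blast
    qed (use \<open>r \<ge> 1\<close> r(2) in auto)
    also have "\<dots> \<le> fact n * (\<bar>C\<bar> * r) / r ^ n"
      using \<open>r \<ge> 1\<close> by (intro divide_right_mono mult_left_mono mult_right_mono) auto
    also have "\<dots> \<le> fact n * (\<bar>C\<bar> * r) / r ^ 2"
      using \<open>r \<ge> 1\<close> that by (intro divide_left_mono power_increasing) auto
    finally have "d * r \<le> fact n * \<bar>C\<bar>"
      using \<open>r \<ge> 1\<close> by (simp add: field_simps power2_eq_square)
    with \<open>fact n * \<bar>C\<bar> + 1 \<le> d * r\<close> show False by simp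
  qed
  have "f z = poly [:f 0, deriv f 0:] z" for z
  proof -
    have "(\<lambda>n. (deriv ^^ n) f 0 / fact n * (z - 0) ^ n) sums f z"
      using holf by (intro holomorphic_power_series[where r = "norm z + 1"])
        (auto intro: holomorphic_on_subset)
    moreover have "(\<lambda>n. (deriv ^^ n) f 0 / fact n * (z - 0) ^ n) sums
        (\<Sum>n\<in>{0,1}. (deriv ^^ n) f 0 / fact n * (z - 0) ^ n)"
      using zero by (intro sums_finite) (auto simp: neq0_conv le_simps numeral_2_eq_2)
    ultimately show ?thesis
      by (auto dest: sums_unique2 simp: mult.commute)
  qed
  then show ?thesis by blast
qed

text \<open>If a value in \<open>ball 0 R\<close> lies outside \<open>f ` ball 0 R\<close>, then \<open>f\<close> omits on \<open>ball 0 R\<close> values of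
  moduli \<open>R\<close> and \<open>2 * R\<close>, and Schottky's theorem bounds \<open>f\<close> linearly on a smaller disc.\<close>

lemma transcendental_fill_ball:
  assumes "transcendental_entire f"
  shows "\<exists>R0. \<forall>R\<ge>R0. ball 0 R \<subseteq> fill (f ` ball 0 R)"
proof (rule ccontr)
  assume "\<not> ?thesis"
  then have bad: "\<exists>R\<ge>R0. \<not> ball 0 R \<subseteq> fill (f ` ball 0 R)" for R0
    by blast
  have holf: "f holomorphic_on UNIV" and nonpoly: "\<nexists>p. f = poly p"
    using assms by (auto simp: transcendental_entire_def)
  \<comment> \<open>Schottky's bound on the disc of radius 1/2 for functions omitting 0 and 1 with
    value at 0 at most \<open>norm (f 0) + 1\<close>; it does not depend on the radius
    \<open>R\<close> chosen later.\<close>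
  define K where "K = exp (pi * exp (pi * (2 + 2 * (norm (f 0) + 1) + 12 * (1/2) / (1 - 1/2))))"
  have "K > 0" by (simp add: K_def)
  \<comment> \<open>The estimate obtained is \<open>R + 3 * R * K\<close> on the disc of radius
    \<open>R / 4\<close>; with \<open>r = R / 4\<close> this is the stated multiple of
    \<open>r\<close>.\<close>
  have "\<exists>r\<ge>r0. \<forall>w. norm w \<le> r \<longrightarrow> norm (f w) \<le> (4 * (1 + 3 * K)) * r" for r0
  proof -
    obtain R where R: "R \<ge> max 1 (4 * r0)" and "\<not> ball 0 R \<subseteq> fill (f ` ball 0 R)"
      using bad by blast
    then obtain w where w: "norm w \<le> R" "w \<in> outside (f ` ball 0 R)"
      by (fastforce simp: fill_eq_outside)
    have "R \<ge> 1" using R by simp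
    have bd: "bounded (f ` ball 0 R)"
      using holf by (intro bounded_continuous_image holomorphic_on_imp_continuous_on) auto
    obtain a where a: "a \<in> outside (f ` ball 0 R)" "norm a = R"
      using outside_meets_sphere[OF bd w(2) w(1)] .
    obtain b where b: "b \<in> outside (f ` ball 0 R)" "norm b = 2 * R"
      using outside_meets_sphere[OF bd w(2), of "2 * R"] w(1) \<open>R \<ge> 1\<close> by auto
    have ab: "R \<le> norm (b - a)" "norm (b - a) \<le> 3 * R"
      using a b norm_triangle_ineq2[of b a] norm_triangle_ineq4[of b a] by auto
    have omit: "f v \<noteq> a" "f v \<noteq> b" if "norm v < R" for v
    proof -
      have "f v \<notin> outside (f ` ball 0 R)"
        using that by (simp add: outside_inside)
      then show "f v \<noteq> a" "f v \<noteq> b" using a(1) b(1) by auto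
    qed
    \<comment> \<open>The affine map sends the omitted values \<open>a\<close> and \<open>b\<close>
      to 0 and 1. Scaling by \<open>R/2\<close> keeps the closed unit disc within
      \<open>ball 0 R\<close>, where the omission holds.\<close>
    define h where "h z = (f (of_real (R/2) * z) - a) / (b - a)" for z
    have "b \<noteq> a" using ab \<open>R \<ge> 1\<close> by auto
    have bound: "norm (h z) \<le> K" if "norm z \<le> 1/2" for z
      unfolding K_def
    proof (rule Schottky[where f = h and t = "1/2"])
      have "(f \<circ> (\<lambda>z. of_real (R/2) * z)) holomorphic_on cball 0 1"
        by (intro holomorphic_on_compose_gen[OF _ holf] holomorphic_intros) auto
      then have "(\<lambda>z. f (of_real (R/2) * z)) holomorphic_on cball 0 1"
        by (simp add: o_def)
      then show "h holomorphic_on cball 0 1"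
        unfolding h_def using \<open>b \<noteq> a\<close> by (intro holomorphic_intros) auto
      have "norm (f 0 - a) \<le> (norm (f 0) + 1) * R"
        using norm_triangle_ineq4[of "f 0" a] a(2) \<open>R \<ge> 1\<close>
          mult_left_mono[of 1 R "norm (f 0)"] by (simp add: algebra_simps)
      also have "\<dots> \<le> (norm (f 0) + 1) * norm (b - a)"
        using ab by (intro mult_left_mono) auto
      finally show "norm (h 0) \<le> norm (f 0) + 1"
        using \<open>b \<noteq> a\<close> by (simp add: h_def norm_divide field_simps)
      show "\<not> (h z = 0 \<or> h z = 1)" if "z \<in> cball 0 1" for z
      proof -
        have "norm (of_real (R/2) * z) \<le> R / 2 * 1"
          using that \<open>R \<ge> 1\<close> unfolding norm_mult norm_of_real by (intro mult_mono) auto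
        then have "norm (of_real (R/2) * z) < R"
          using \<open>R \<ge> 1\<close> by linarith
        from omit[OF this] show ?thesis
          using \<open>b \<noteq> a\<close> by (simp add: h_def)
      qed
    qed (use that in auto)
    have "norm (f w) \<le> (4 * (1 + 3 * K)) * (R / 4)" if "norm w \<le> R / 4" for w
    proof -
      define z where "z = w / of_real (R/2)"
      have z: "w = of_real (R/2) * z" "norm z \<le> 1/2"
        using that \<open>R \<ge> 1\<close> by (auto simp: z_def norm_divide field_simps)
      have "f w = a + (b - a) * h z"
        using \<open>b \<noteq> a\<close> by (simp add: h_def z(1))
      then have "norm (f w) \<le> norm a + norm (b - a) * norm (h z)"
        by (metis norm_mult norm_triangle_ineq)
      also have "\<dots> \<le> R + (3 * R) * K"
        using a(2) ab bound[OF z(2)] by (intro add_mono mult_mono) auto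
      finally show ?thesis by (simp add: algebra_simps)
    qed
    moreover have "R / 4 \<ge> r0" using R by simp
    ultimately show ?thesis by blast
  qed
  then show False
    using affine_growth_imp_polynomial[OF holf] nonpoly by blast
qed

text \<open>The omitted values may be chosen on circles as large as we please. Taking the circle after a
  bound for the sequence at one point \<open>w\<close> makes the normalised functions bounded by \<open>1\<close> at \<open>w\<close>;
  if there is no such bound, the reciprocals of the normalised functions tend to \<open>0\<close> by Hurwitz.\<close>

lemma normal_family_omitting_circles:
  assumes S: "open S" "connected S" "S \<noteq> {}"
    and hol: "\<And>h. h \<in> \<F> \<Longrightarrow> h holomorphic_on S"
    and omit: "\<And>h r. h \<in> \<F> \<Longrightarrow> r \<ge> R \<Longrightarrow> \<exists>a. norm a = r \<and> a \<notin> h ` S"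
  shows "normal_family_on \<F> S"
  unfolding normal_family_on_def
proof (intro allI impI)
  fix s :: "nat \<Rightarrow> complex \<Rightarrow> complex"
  assume s: "range s \<subseteq> \<F>"
  obtain w where w: "w \<in> S" using S(3) by blast
  define X where "X = {h. h holomorphic_on S \<and> (\<forall>z\<in>S. h z \<noteq> 0 \<and> h z \<noteq> 1)}"
  \<comment> \<open>Omitted values of moduli \<open>r\<close> and \<open>10 * r\<close> differ by
    between \<open>9 * r\<close> and \<open>11 * r\<close>, so the normalisations are comparable for
    all \<open>n\<close>.\<close>
  have normalise: "\<exists>a b. \<forall>n. norm (a n) = r \<and> 9 * r \<le> norm (b n - a n) \<and> norm (b n - a n) \<le> 11 * r
      \<and> (\<lambda>z. (s n z - a n) / (b n - a n)) \<in> X" if "r \<ge> R" "r > 0" for r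
  proof -
    have "\<exists>a. norm a = r \<and> a \<notin> s n ` S" "\<exists>b. norm b = 10 * r \<and> b \<notin> s n ` S" for n
      using s that by (auto intro!: omit)
    then obtain a b where ab: "\<And>n. norm (a n) = r" "\<And>n. a n \<notin> s n ` S"
        "\<And>n. norm (b n) = 10 * r" "\<And>n. b n \<notin> s n ` S"
      by metis
    have d: "9 * r \<le> norm (b n - a n)" "norm (b n - a n) \<le> 11 * r" for n
      using norm_triangle_ineq2[of "b n" "a n"] norm_triangle_ineq4[of "b n" "a n"] ab by auto
    have ne: "b n \<noteq> a n" for n using d(1)[of n] \<open>r > 0\<close> by auto
    have "(\<lambda>z. (s n z - a n) / (b n - a n)) \<in> X" for n
    proof -
      have "s n holomorphic_on S" using s by (intro hol) auto
      then have "(\<lambda>z. (s n z - a n) / (b n - a n)) holomorphic_on S"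
        using ne by (intro holomorphic_intros) auto
      moreover have "s n z \<noteq> a n \<and> s n z \<noteq> b n" if "z \<in> S" for z
        using imageI[OF that, of "s n"] ab(2,4) by metis
      ultimately show ?thesis
        using ne[of n] by (auto simp: X_def)
    qed
    then show ?thesis using ab d by blast
  qed
  \<comment> \<open>For functions omitting 0 and 1, a common bound at one point spreads to every
    compact subset of the domain.\<close>
  have sub_bound: "\<exists>B. \<forall>h\<in>Y. \<forall>z\<in>K. norm (h z) \<le> B"
    if Y: "Y \<subseteq> X" "\<And>h. h \<in> Y \<Longrightarrow> norm (h w) \<le> 1" "compact K" "K \<subseteq> S" for Y K
  proof -
    obtain B where "\<And>h z. \<lbrakk>h \<in> Y; z \<in> K\<rbrakk> \<Longrightarrow> norm (h z) \<le> B"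
      by (rule GPicard3[of S w Y X K]) (use Y S w in \<open>auto simp: X_def\<close>)
    then show ?thesis by blast
  qed
  show "\<exists>r. strict_mono r \<and>
      ((\<exists>g. g holomorphic_on S \<and>
         (\<forall>K. compact K \<and> K \<subseteq> S \<longrightarrow> uniform_limit K (\<lambda>n. s (r n)) g sequentially)) \<or>
       (\<forall>K. compact K \<and> K \<subseteq> S \<longrightarrow>
         (\<forall>M::real. \<forall>\<^sub>F n in sequentially. \<forall>z\<in>K. M < norm (s (r n) z))))"
  proof (cases "\<exists>M. infinite {n. norm (s n w) \<le> M}")
    case True
    then obtain M where "infinite {n. norm (s n w) \<le> M}" by blast
    then obtain q :: "nat \<Rightarrow> nat" where q: "strict_mono q" "\<And>n. norm (s (q n) w) \<le> M"
      using infinite_enumerate by blast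
    define r where "r = max 1 (max R M)"
    have r: "r \<ge> R" "r > 0" "r \<ge> M" by (auto simp: r_def)
    obtain a b where ab: "\<And>n. norm (a n) = r" "\<And>n. 9 * r \<le> norm (b n - a n)"
        "\<And>n. norm (b n - a n) \<le> 11 * r" "\<And>n. (\<lambda>z. (s n z - a n) / (b n - a n)) \<in> X"
      using normalise[OF r(1,2)] by metis
    define g where "g n z = (s n z - a n) / (b n - a n)" for n z
    have "norm (g (q n) w) \<le> 1" for n
    proof -
      have "norm (s (q n) w - a (q n)) \<le> norm (b (q n) - a (q n))"
        using norm_triangle_ineq4[of "s (q n) w" "a (q n)"] q(2)[of n] ab(1,2)[of "q n"] r by auto
      then show ?thesis
        using ab(2)[of "q n"] r by (auto simp: g_def norm_divide divide_simps)
    qed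
    then have gbd: "\<exists>B. \<forall>n. \<forall>z\<in>K. norm (g (q n) z) \<le> B" if "compact K" "K \<subseteq> S" for K
      using sub_bound[of "range (\<lambda>n. g (q n))" K] that ab(4)
      by (auto simp: g_def[abs_def])
    have sbd: "\<exists>B. \<forall>h\<in>range (\<lambda>n. s (q n)). \<forall>z\<in>K. norm (h z) \<le> B" if K: "compact K" "K \<subseteq> S" for K
    proof -
      obtain B where B: "\<And>n z. z \<in> K \<Longrightarrow> norm (g (q n) z) \<le> B"
        using gbd[OF K] by blast
      have "norm (s (q n) z) \<le> r + 11 * r * B" if "z \<in> K" for n z
      proof -
        have "s (q n) z = a (q n) + (b (q n) - a (q n)) * g (q n) z"
          using ab(2)[of "q n"] r by (auto simp: g_def)
        then have "norm (s (q n) z) \<le> norm (a (q n)) + norm (b (q n) - a (q n)) * norm (g (q n) z)"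
          by (metis norm_mult norm_triangle_ineq)
        also have "\<dots> \<le> r + (11 * r) * B"
          using ab B[OF that] r by (intro add_mono mult_mono) auto
        finally show ?thesis .
      qed
      then show ?thesis by blast
    qed
    have "h holomorphic_on S" if "h \<in> range (\<lambda>n. s (q n))" for h
      using that s by (intro hol) auto
    then obtain g' r' where gr: "g' holomorphic_on S" "strict_mono (r' :: nat \<Rightarrow> nat)"
        "\<And>K. \<lbrakk>compact K; K \<subseteq> S\<rbrakk> \<Longrightarrow> uniform_limit K ((\<lambda>n. s (q n)) \<circ> r') g' sequentially"
      by (rule Montel[where \<F> = "\<lambda>n. s (q n)", OF S(1) _ sbd]) blast+
    have "strict_mono (q \<circ> r')"
      using q(1) gr(2) by (rule strict_mono_o)
    then show ?thesis
      using gr by (intro exI[of _ "q \<circ> r'"]) (auto simp: o_def)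
  next
    case False
    define r where "r = max 1 R"
    have r: "r \<ge> R" "r > 0" by (auto simp: r_def)
    obtain a b where ab: "\<And>n. norm (a n) = r" "\<And>n. 9 * r \<le> norm (b n - a n)"
        "\<And>n. norm (b n - a n) \<le> 11 * r" "\<And>n. (\<lambda>z. (s n z - a n) / (b n - a n)) \<in> X"
      using normalise[OF r(1,2)] by metis
    define g where "g n z = (s n z - a n) / (b n - a n)" for n z
    have g: "g n holomorphic_on S" "\<And>z. z \<in> S \<Longrightarrow> g n z \<noteq> 0 \<and> g n z \<noteq> 1" for n
      using ab(4)[of n] by (auto simp: X_def g_def[abs_def])
    \<comment> \<open>The two comparisons serve opposite directions: \<open>glow\<close> carries the
      divergence at \<open>w\<close> from \<open>s\<close> to \<open>g\<close>, and
      \<open>gup\<close> brings divergence on compact sets back from \<open>g\<close> to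
      \<open>s\<close>.\<close>
    have glow: "norm (s n z) - r \<le> 11 * r * norm (g n z)" for n z
    proof -
      have "norm (s n z) - r \<le> norm (s n z - a n)"
        using norm_triangle_ineq2[of "s n z" "a n"] ab(1) by simp
      also have "\<dots> = norm (b n - a n) * norm (g n z)"
        using ab(2)[of n] r by (auto simp: g_def norm_divide)
      also have "\<dots> \<le> 11 * r * norm (g n z)"
        using ab(3) by (intro mult_right_mono) auto
      finally show ?thesis .
    qed
    have gup: "9 * r * norm (g n z) - r \<le> norm (s n z)" for n z
    proof -
      have "9 * r * norm (g n z) \<le> norm (b n - a n) * norm (g n z)"
        using ab(2) by (intro mult_right_mono) auto
      also have "\<dots> = norm (s n z - a n)"
        using ab(2)[of n] r by (auto simp: g_def norm_divide)
      also have "\<dots> \<le> norm (s n z) + r"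
        using norm_triangle_ineq4[of "s n z" "a n"] ab(1) by simp
      finally show ?thesis by simp
    qed
    have large: "\<forall>\<^sub>F n in sequentially. B < norm (g n w)" for B
    proof -
      have "finite {n. norm (s n w) \<le> r + 11 * r * B}"
        using False by blast
      then have "\<forall>\<^sub>F n in sequentially. \<not> norm (s n w) \<le> r + 11 * r * B"
        by (auto simp: cofinite_eq_sequentially[symmetric] eventually_cofinite)
      then show ?thesis
      proof eventually_elim
        case (elim n)
        then have "11 * r * B < 11 * r * norm (g n w)"
          using glow[of n w] by linarith
        then show ?case using r by simp
      qed
    qed
    obtain N where N: "\<And>n. n \<ge> N \<Longrightarrow> 1 < norm (g n w)"
      using large[of 1] by (auto simp: eventually_sequentially)
    \<comment> \<open>Reciprocals also omit 0 and 1; dropping the first \<open>N\<close> terms makes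
      them bounded by 1 at \<open>w\<close>.\<close>
    define k where "k n z = inverse (g (n + N) z)" for n z
    have kX: "k n \<in> X" for n
      using g by (auto simp: X_def k_def[abs_def] intro!: holomorphic_on_inverse)
    have "norm (k n w) \<le> 1" for n
      using N[of "n + N"] by (simp add: k_def norm_inverse inverse_le_1_iff)
    then have kbd: "\<exists>B. \<forall>h\<in>range k. \<forall>z\<in>K. norm (h z) \<le> B" if "compact K" "K \<subseteq> S" for K
      using sub_bound[of "range k" K] that kX by blast
    have "h holomorphic_on S" if "h \<in> range k" for h
      using that kX by (auto simp: X_def)
    then obtain h r' where h: "h holomorphic_on S" "strict_mono (r' :: nat \<Rightarrow> nat)"
        "\<And>x. x \<in> S \<Longrightarrow> (\<lambda>n. k (r' n) x) \<longlonglongrightarrow> h x"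
        "\<And>K. \<lbrakk>compact K; K \<subseteq> S\<rbrakk> \<Longrightarrow> uniform_limit K (k \<circ> r') h sequentially"
      by (rule Montel[where \<F> = k, OF S(1) _ kbd]) blast+
    have "filterlim (\<lambda>n. g n w) at_infinity sequentially"
      using large by (auto simp: filterlim_at_infinity[of 0] intro: eventually_mono less_imp_le)
    then have "(\<lambda>n. inverse (g n w)) \<longlonglongrightarrow> 0"
      by (rule filterlim_compose[OF tendsto_inverse_0])
    then have "(\<lambda>n. k n w) \<longlonglongrightarrow> 0"
      unfolding k_def by (rule LIMSEQ_ignore_initial_segment)
    then have "(\<lambda>n. k (r' n) w) \<longlonglongrightarrow> 0"
      using LIMSEQ_subseq_LIMSEQ[OF _ h(2)] by (force simp: o_def)
    then have "h w = 0"
      using h(3)[OF w] LIMSEQ_unique by blast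
    have "h constant_on S"
    proof (rule ccontr)
      assume "\<not> h constant_on S"
      then have "h w \<noteq> 0"
        using S w h kX
        by (intro Hurwitz_no_zeros[of S "k \<circ> r'" h]) (auto simp: X_def)
      then show False using \<open>h w = 0\<close> by simp
    qed
    then have h0: "h z = 0" if "z \<in> S" for z
      using \<open>h w = 0\<close> w that by (auto simp: constant_on_def)
    have "\<forall>\<^sub>F n in sequentially. \<forall>z\<in>K. M < norm (s (r' n + N) z)" if K: "compact K" "K \<subseteq> S" for K M
    proof -
      \<comment> \<open>Smallness below \<open>e\<close> means
        \<open>norm g > \<bar>M\<bar> + 2\<close>. Then \<open>r \<le> r * norm g\<close>, so
        \<open>gup\<close> leaves at least \<open>8 * r * norm g\<close>, which exceeds
        \<open>M\<close>.\<close>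
      define e where "e = 1 / (\<bar>M\<bar> + 2)"
      have "e > 0" by (simp add: e_def)
      then have "\<forall>\<^sub>F n in sequentially. \<forall>z\<in>K. dist (k (r' n) z) (h z) < e"
        using uniform_limitD[OF h(4)[OF K]] by (simp add: o_def)
      then show ?thesis
      proof eventually_elim
        case (elim n)
        show ?case
        proof
          fix z assume "z \<in> K"
          then have z: "z \<in> S" using K by blast
          have "norm (k (r' n) z) < e"
            using elim \<open>z \<in> K\<close> h0[OF z] by auto
          then have "inverse (norm (g (r' n + N) z)) < inverse (\<bar>M\<bar> + 2)"
            by (simp add: k_def e_def norm_inverse inverse_eq_divide[of "\<bar>M\<bar> + 2"])
          then have "\<bar>M\<bar> + 2 < norm (g (r' n + N) z)"
            using g(2)[OF z, of "r' n + N"] inverse_less_imp_less by auto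
          moreover have "1 * norm (g (r' n + N) z) \<le> r * norm (g (r' n + N) z)"
            by (intro mult_right_mono) (auto simp: r_def)
          moreover have "r * 1 \<le> r * norm (g (r' n + N) z)"
            using calculation(1) r by (intro mult_left_mono) auto
          ultimately show "M < norm (s (r' n + N) z)"
            using gup[of "r' n + N" z] by linarith
        qed
      qed
    qed
    moreover have "strict_mono (\<lambda>n. r' n + N)"
      using h(2) by (simp add: strict_mono_def)
    ultimately show ?thesis
      by (intro exI[of _ "\<lambda>n. r' n + N"]) auto
  qed
qed

section \<open>Iterates of a transcendental entire function\<close>

locale transcendental =
  fixes f :: "complex \<Rightarrow> complex"
  assumes trans: "transcendental_entire f"
begin

lemma holomorphic: "f holomorphic_on UNIV"
  using trans by (simp add: transcendental_entire_def)

lemma iterate_holomorphic: "(f ^^ n) holomorphic_on UNIV"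
proof (induction n)
  case (Suc n)
  then show ?case
    using holomorphic_on_compose_gen[OF Suc holomorphic] by (simp add: o_def)
qed (simp add: id_def)

lemma iterate_continuous: "continuous_on A (f ^^ n)"
  using iterate_holomorphic holomorphic_on_imp_continuous_on continuous_on_subset by blast

lemma iterate_open_map: "open S \<Longrightarrow> open ((f ^^ n) ` S)"
proof (induction n)
  case (Suc n)
  have "\<not> f constant_on UNIV"
  proof
    assume "f constant_on UNIV"
    then obtain c where "\<And>z. f z = c"
      by (auto simp: constant_on_def)
    then have "f = poly [:c:]"
      by (simp add: fun_eq_iff)
    then show False
      using trans by (auto simp: transcendental_entire_def)
  qed
  then have "open (f ` (f ^^ n) ` S)"
    using Suc by (intro open_mapping_thm[OF holomorphic]) auto
  then show ?case
    by (simp add: image_comp)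
qed simp

lemma bounded_iterate_image: "bounded G \<Longrightarrow> bounded ((f ^^ n) ` G)"
  by (rule bounded_continuous_image[OF iterate_continuous])

lemma iterate_fill_subset:
  assumes "open G" "bounded G"
  shows "(f ^^ k) ` fill ((f ^^ n) ` G) \<subseteq> fill ((f ^^ (n + k)) ` G)"
  using image_fill_subset[OF iterate_continuous iterate_open_map, of "(f ^^ n) ` G" k]
    iterate_open_map[of G n] bounded_iterate_image[of G n] assms
  by (simp add: image_comp funpow_add[symmetric] add.commute)

section \<open>Filled images of discs meeting the Julia set\<close>

lemma julia_disc:
  assumes "disc_meeting_julia f D"
  shows "open D" "bounded D"
  using assms by (auto simp: disc_meeting_julia_def)

lemma eventually_ball_subset_fill:
  assumes D: "disc_meeting_julia f D"
  shows "\<forall>\<^sub>F n in sequentially. ball 0 R \<subseteq> fill ((f ^^ n) ` D)"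
proof -
  obtain R0 where R0: "\<And>R. R \<ge> R0 \<Longrightarrow> ball 0 R \<subseteq> fill (f ` ball 0 R)"
    using transcendental_fill_ball[OF trans] by blast
  \<comment> \<open>Being at least \<open>R0\<close>, this radius allows the inclusion to pass from
    one iterate to the next.\<close>
  define r where "r = max R R0"
  have step: "ball 0 r \<subseteq> fill ((f ^^ Suc n) ` D)" if "ball 0 r \<subseteq> fill ((f ^^ n) ` D)" for n
  proof -
    have "f ` ball 0 r \<subseteq> fill ((f ^^ Suc n) ` D)"
      using that iterate_fill_subset[OF julia_disc[OF D], of 1 n] by auto
    then have "fill (f ` ball 0 r) \<subseteq> fill ((f ^^ Suc n) ` D)"
      by (intro fill_subset bounded_iterate_image julia_disc[OF D])
    then show ?thesis
      using R0[of r] by (auto simp: r_def)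
  qed
  have "\<exists>m. ball 0 r \<subseteq> fill ((f ^^ m) ` D)"
  proof (rule ccontr)
    assume "\<nexists>m. ball 0 r \<subseteq> fill ((f ^^ m) ` D)"
    then have none: "\<not> ball 0 r \<subseteq> fill ((f ^^ m) ` D)" for m by blast
    have "plane_domain D"
      using D by (auto simp: disc_meeting_julia_def plane_domain_def)
    then have "normal_family_on {f ^^ n | n. n \<ge> 1} D"
    proof (intro normal_family_omitting_circles[where R = r])
      fix h t assume h: "h \<in> {f ^^ n | n. n \<ge> 1}" and "r \<le> t"
      then obtain n where n: "h = f ^^ n" by blast
      obtain w where w: "w \<in> ball 0 r" "w \<in> outside (h ` D)"
        using none[of n] n by (auto simp: fill_eq_outside)
      moreover have "norm w \<le> t" using w \<open>r \<le> t\<close> by simp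
      moreover have "bounded (h ` D)"
        unfolding n by (intro bounded_iterate_image julia_disc[OF D])
      ultimately obtain a where "a \<in> outside (h ` D)" "norm a = t"
        using outside_meets_sphere by blast
      then show "\<exists>a. norm a = t \<and> a \<notin> h ` D"
        using outside_no_overlap[of "h ` D"] by blast
    next
      show "h holomorphic_on D" if "h \<in> {f ^^ n | n. n \<ge> 1}" for h
        using that iterate_holomorphic holomorphic_on_subset by blast
    qed (auto simp: plane_domain_def)
    then have "D \<subseteq> fatou_set f"
      using \<open>plane_domain D\<close> by (auto simp: fatou_set_def)
    then show False
      using D by (auto simp: disc_meeting_julia_def julia_set_def)
  qed
  then obtain m where m: "ball 0 r \<subseteq> fill ((f ^^ m) ` D)" by blast
  have "ball 0 r \<subseteq> fill ((f ^^ n) ` D)" if "n \<ge> m" for n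
    using that by (induction n rule: dec_induct) (use m step in auto)
  moreover have "ball 0 R \<subseteq> ball (0::complex) r"
    by (auto simp: r_def)
  ultimately show ?thesis
    by (metis (no_types, lifting) eventually_sequentially subset_trans)
qed

text \<open>Some filled image of \<open>D\<close> contains \<open>E\<close>, and further iteration
  preserves this. The same \<open>k\<close> serves all \<open>m\<close>, so it can act as a
  lag.\<close>

lemma eventually_fill_subset:
  assumes D: "disc_meeting_julia f D" and "bounded E"
  shows "\<forall>\<^sub>F k in sequentially. \<forall>m. fill ((f ^^ m) ` E) \<subseteq> fill ((f ^^ (m + k)) ` D)"
proof -
  obtain R where R: "E \<subseteq> ball 0 R"
    using assms(2) by (meson bounded_subset_ballD)
  show ?thesis
    using eventually_ball_subset_fill[OF D, of R]
  proof eventually_elim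
    case (elim k)
    show ?case
    proof
      fix m
      have "(f ^^ m) ` E \<subseteq> (f ^^ m) ` fill ((f ^^ k) ` D)"
        using R elim by blast
      also have "\<dots> \<subseteq> fill ((f ^^ (m + k)) ` D)"
        using iterate_fill_subset[OF julia_disc[OF D], of m k] by (simp add: add.commute)
      finally show "fill ((f ^^ m) ` E) \<subseteq> fill ((f ^^ (m + k)) ` D)"
        by (intro fill_subset bounded_iterate_image julia_disc[OF D])
    qed
  qed
qed

text \<open>Fixing the lag removes the existential quantifier from \<open>B_set\<close>. Lag 0 gives
  \<open>B_disc\<close>, so one argument treats both sets.\<close>

definition B_shift :: "nat \<Rightarrow> complex set \<Rightarrow> complex set" where
  "B_shift L E = {z. \<forall>n\<ge>1. (f ^^ (n + L)) z \<notin> fill ((f ^^ n) ` E)}"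

lemma B_disc_eq_shift: "B_disc f E = B_shift 0 E"
  by (simp add: B_disc_def B_shift_def)

lemma B_set_eq_shift: "B_set f E = (\<Union>L\<in>{1..}. B_shift L E)"
  by (auto simp: B_set_def B_shift_def)

lemma B_shift_reaches_sphere:
  assumes E: "open E" "bounded E" and z: "z \<in> B_shift L E" "norm z \<le> R"
  obtains C where "connected C" "z \<in> C" "C \<subseteq> B_shift L E" "C \<inter> sphere 0 R \<noteq> {}"
proof -
  define X where "X n = (f ^^ (Suc n + L)) -` outside ((f ^^ Suc n) ` E)" for n
  have X: "(\<Inter>n. X n) = B_shift L E"
    by (auto simp: X_def B_shift_def fill_eq_outside Suc_le_eq gr0_conv_Suc simp del: funpow.simps)
  have out: "closed (outside ((f ^^ n) ` E))" "connected (outside ((f ^^ n) ` E))"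
      "\<not> bounded (outside ((f ^^ n) ` E))" for n
    using iterate_open_map[OF E(1)] bounded_iterate_image[OF E(2)]
    by (auto simp: closed_outside_open connected_outside unbounded_outside)
  have closed: "closed (X n)" for n
    unfolding X_def by (intro closed_vimage out(1) iterate_continuous)
  \<comment> \<open>\<open>f\<close> maps each filled image of \<open>E\<close> into the next one,
    so a point outside at one stage was outside at the stage before.\<close>
  have "X (Suc n) \<subseteq> X n" for n
  proof
    fix x assume "x \<in> X (Suc n)"
    then have "f ((f ^^ (Suc n + L)) x) \<notin> fill ((f ^^ (Suc n + 1)) ` E)"
      by (simp add: X_def fill_eq_outside)
    then have "(f ^^ (Suc n + L)) x \<notin> fill ((f ^^ Suc n) ` E)"
      using iterate_fill_subset[OF E, of 1 "Suc n"] by (simp add: image_subset_iff) blast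
    then show "x \<in> X n"
      by (simp add: X_def fill_eq_outside)
  qed
  then have "decseq X"
    by (rule decseq_SucI)
  moreover have "connected_component_set (X n \<inter> cball 0 R) z \<inter> sphere 0 R \<noteq> {}" for n
  proof -
    have "z \<in> X n" using X z(1) by blast
    then show ?thesis
      unfolding X_def
      by (intro preimage_component_meets_sphere iterate_continuous iterate_open_map out z(2)) auto
  qed
  ultimately obtain C where "connected C" "z \<in> C" "C \<subseteq> (\<Inter>n. X n)" "C \<inter> sphere 0 R \<noteq> {}"
    using nested_components_meet_sphere[of X R z] closed by metis
  then show ?thesis
    using that X by metis
qed

lemma B_set_reaches_sphere:
  assumes E: "open E" "bounded E" and z: "z \<in> B_set f E" "norm z \<le> R"
  obtains C where "connected C" "z \<in> C" "C \<subseteq> B_set f E" "C \<inter> sphere 0 R \<noteq> {}"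
proof -
  obtain L where L: "L \<ge> 1" "z \<in> B_shift L E"
    using z(1) by (auto simp: B_set_eq_shift)
  obtain C where "connected C" "z \<in> C" "C \<subseteq> B_shift L E" "C \<inter> sphere 0 R \<noteq> {}"
    using B_shift_reaches_sphere[OF E L(2) z(2)] .
  then show ?thesis
    using that[of C] L(1) by (auto simp: B_set_eq_shift)
qed

text \<open>Filled images of \<open>E\<close> lie in those of \<open>D\<close> taken
  \<open>k\<close> steps later, so \<open>k\<close> serves as the lag.\<close>

lemma B_disc_subset_B_set:
  assumes D: "disc_meeting_julia f D" and "bounded E"
  shows "B_disc f D \<subseteq> B_set f E"
proof
  fix z assume z: "z \<in> B_disc f D"
  obtain k where k: "k \<ge> 1" "\<And>m. fill ((f ^^ m) ` E) \<subseteq> fill ((f ^^ (m + k)) ` D)"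
    using eventually_conj[OF eventually_ge_at_top[of 1] eventually_fill_subset[OF assms]]
    by (auto dest: eventually_happens)
  have "(f ^^ (n + k)) z \<notin> fill ((f ^^ n) ` E)" if "n \<ge> 1" for n
    using z k(2)[of n] that by (auto simp: B_disc_def)
  then show "z \<in> B_set f E"
    using k(1) by (auto simp: B_set_def)
qed

text \<open>The delayed orbit stays out of filled images of \<open>D\<close> that eventually contain
  any given disc.\<close>

lemma B_set_subset_escaping:
  assumes D: "disc_meeting_julia f D"
  shows "B_set f D \<subseteq> escaping_set f"
proof
  fix z assume "z \<in> B_set f D"
  then obtain L where L: "\<And>n. n \<ge> 1 \<Longrightarrow> (f ^^ (n + L)) z \<notin> fill ((f ^^ n) ` D)"
    by (auto simp: B_set_def)
  have "\<forall>\<^sub>F n in sequentially. R \<le> norm ((f ^^ (n + L)) z)" for R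
    using eventually_ball_subset_fill[OF D, of R] eventually_ge_at_top[of 1]
  proof eventually_elim
    case (elim n)
    then show ?case using L[of n] by (auto simp: subset_iff not_less)
  qed
  then have "\<forall>\<^sub>F n in sequentially. R \<le> norm ((f ^^ n) z)" for R
    using eventually_sequentially_seg[of "\<lambda>n. R \<le> norm ((f ^^ n) z)" L] by simp
  then show "z \<in> escaping_set f"
    by (simp add: escaping_set_def filterlim_at_infinity[of 0])
qed

lemma B_set_backward_invariant: "(f ^^ n) z \<in> B_set f D \<Longrightarrow> z \<in> B_set f D"
proof -
  assume "(f ^^ n) z \<in> B_set f D"
  then obtain L where "L \<ge> 1" "\<And>m. m \<ge> 1 \<Longrightarrow> (f ^^ (m + L)) ((f ^^ n) z) \<notin> fill ((f ^^ m) ` D)"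
    by (auto simp: B_set_def)
  then show "z \<in> B_set f D"
    unfolding B_set_def
    by (intro CollectI exI[of _ "L + n"]) (auto simp: funpow_add)
qed

end

section \<open>Images of a surrounding boundary\<close>

text \<open>Instantiated twice: with the given domain, and with its filling, whose frontier is
  connected.\<close>

locale surrounding_boundary = transcendental +
  fixes D U :: "complex set"
  assumes D: "disc_meeting_julia f D"
    and U: "open U" "bounded U"
    and frontier_U: "frontier U \<subseteq> B_disc f D"
    and U_julia: "U \<inter> julia_set f \<noteq> {}"
begin

abbreviation "\<beta> n \<equiv> (f ^^ n) ` frontier U"

lemma frontier_nonempty: "frontier U \<noteq> {}"
  using U U_julia not_bounded_UNIV by (auto simp: frontier_eq_empty)

lemma bounded_beta: "bounded (\<beta> n)"
  using U(2) by (intro bounded_iterate_image) (metis bounded_closure bounded_subset frontier_def Diff_subset)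

lemma eventually_beta_disjoint_ball:
  "\<forall>\<^sub>F n in sequentially. \<beta> n \<inter> ball 0 R = {}"
  using eventually_ball_subset_fill[OF D, of R] eventually_ge_at_top[of 1]
proof eventually_elim
  case (elim n)
  then show ?case
    using frontier_U by (auto simp: B_disc_def)
qed

lemma beta_tendsto_infinity: "sets_tend_to_infinity \<beta>"
  unfolding sets_tend_to_infinity_def filterlim_at_top
proof
  fix R
  show "\<forall>\<^sub>F n in sequentially. R \<le> (INF z\<in>\<beta> n. norm z)"
    using eventually_beta_disjoint_ball[of R]
  proof eventually_elim
    case (elim n)
    then show ?case
      using frontier_nonempty by (intro cINF_greatest) (auto simp: disjoint_iff not_less)
  qed
qed

text \<open>At time \<open>m + n\<close> the orbit of a frontier point avoids the filled image of
  \<open>D\<close> for that time, which for large \<open>n\<close> contains the one for time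
  \<open>m\<close>.\<close>

lemma eventually_beta_subset_B_disc: "\<forall>\<^sub>F n in sequentially. \<beta> n \<subseteq> B_disc f D"
  using eventually_fill_subset[OF D julia_disc(2)[OF D]]
proof eventually_elim
  case (elim n)
  show ?case
  proof
    fix w assume "w \<in> \<beta> n"
    then obtain z where z: "z \<in> frontier U" "w = (f ^^ n) z" by blast
    then have "(f ^^ (m + n)) z \<notin> fill ((f ^^ (m + n)) ` D)" if "m \<ge> 1" for m
      using frontier_U that by (auto simp: B_disc_def)
    then show "w \<in> B_disc f D"
      using elim by (auto simp: B_disc_def z(2) funpow_add)
  qed
qed

lemma fill_image_subset_inside_beta: "fill ((f ^^ n) ` U) - \<beta> n \<subseteq> inside (\<beta> n)"
proof -
  let ?G = "(f ^^ n) ` U"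
  have G: "open ?G" "bounded ?G"
    using U iterate_open_map bounded_iterate_image by blast+
  have "closure ?G \<subseteq> (f ^^ n) ` closure U"
    using U(2) by (intro closure_minimal image_mono closure_subset compact_imp_closed
        compact_continuous_image iterate_continuous) simp
  also have "\<dots> \<subseteq> ?G \<union> \<beta> n"
    by (auto simp: closure_Un_frontier)
  finally have fr: "frontier ?G \<subseteq> \<beta> n"
    using G(1) by (auto simp: frontier_def interior_open)
  have O: "connected (outside (\<beta> n))" "\<not> bounded (outside (\<beta> n))"
    by (simp_all add: connected_outside unbounded_outside bounded_beta)
  have "outside (\<beta> n) \<inter> ?G = {}"
  proof (rule ccontr)
    assume "outside (\<beta> n) \<inter> ?G \<noteq> {}"
    moreover have "outside (\<beta> n) - ?G \<noteq> {}"
      using O(2) G(2) bounded_subset by blast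
    ultimately have "outside (\<beta> n) \<inter> frontier ?G \<noteq> {}"
      by (rule connected_Int_frontier[OF O(1)])
    then show False
      using fr outside_no_overlap[of "\<beta> n"] by blast
  qed
  then have "outside (\<beta> n) \<subseteq> outside ?G"
    using O by (intro unbounded_connected_imp_outside)
  then show ?thesis
    by (auto simp: fill_eq_outside inside_outside)
qed

text \<open>A small disc in \<open>U\<close> about a Julia point has filled images swallowing any
  ball, while \<open>\<beta> n\<close> leaves that ball.\<close>

lemma eventually_ball_subset_inside_beta:
  "\<forall>\<^sub>F n in sequentially. ball 0 R \<subseteq> inside (\<beta> n)"
proof -
  obtain z where z: "z \<in> U" "z \<in> julia_set f"
    using U_julia by blast
  obtain e where e: "e > 0" "ball z e \<subseteq> U"
    using U(1) z(1) openE by blast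
  then have "disc_meeting_julia f (ball z e)"
    using z(2) centre_in_ball[of z e] unfolding disc_meeting_julia_def by blast
  then show ?thesis
    using eventually_ball_subset_fill[of "ball z e" R] eventually_beta_disjoint_ball[of R]
  proof (elim eventually_elim2)
    fix n assume *: "ball 0 R \<subseteq> fill ((f ^^ n) ` ball z e)" "\<beta> n \<inter> ball 0 R = {}"
    have "fill ((f ^^ n) ` ball z e) \<subseteq> fill ((f ^^ n) ` U)"
      using e(2) by (intro fill_mono image_mono)
    then show "ball 0 R \<subseteq> inside (\<beta> n)"
      using * fill_image_subset_inside_beta[of n] by blast
  qed
qed

text \<open>For two points of \<open>A\<close>, take a connected \<open>\<beta> n\<close> in
  \<open>A\<close> surrounding both. Connected subsets of \<open>A\<close> from each point to a
  circle beyond \<open>\<beta> n\<close> cross it, and the three sets unite.\<close>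

lemma connected_if_reaches_spheres:
  assumes conn: "connected (frontier U)"
    and A: "\<forall>\<^sub>F n in sequentially. \<beta> n \<subseteq> A"
    and reach: "\<And>z R. z \<in> A \<Longrightarrow> norm z \<le> R \<Longrightarrow>
      \<exists>C. connected C \<and> z \<in> C \<and> C \<subseteq> A \<and> C \<inter> sphere 0 R \<noteq> {}"
  shows "connected A"
proof -
  have "\<exists>T. connected T \<and> T \<subseteq> A \<and> x \<in> T \<and> y \<in> T" if xy: "x \<in> A" "y \<in> A" for x y
  proof -
    define r where "r = max (norm x) (norm y) + 1"
    obtain n where n: "ball 0 r \<subseteq> inside (\<beta> n)" "\<beta> n \<subseteq> A"
      using eventually_conj[OF eventually_ball_subset_inside_beta[of r] A]
      by (auto dest: eventually_happens)
    obtain R where R: "\<beta> n \<subseteq> ball 0 R" "r \<le> R"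
    proof -
      obtain R' where "\<beta> n \<subseteq> ball 0 R'"
        using bounded_beta bounded_subset_ballD by blast
      then show ?thesis
        by (intro that[of "max R' r"]) force+
    qed
    have "\<exists>C. connected C \<and> z \<in> C \<and> C \<subseteq> A \<and> C \<inter> \<beta> n \<noteq> {}" if z: "z \<in> A" "norm z < r" for z
    proof -
      obtain C where C: "connected C" "z \<in> C" "C \<subseteq> A" "C \<inter> sphere 0 R \<noteq> {}"
        using reach[of z R] z R(2) by auto
      have "z \<in> inside (\<beta> n)" using n(1) z(2) by auto
      then have "C \<inter> \<beta> n \<noteq> {}"
        using connected_meets_surrounding C R(1) by blast
      then show ?thesis using C by blast
    qed
    moreover have "norm x < r" "norm y < r" by (auto simp: r_def)
    ultimately obtain C C' where C: "connected C" "x \<in> C" "C \<subseteq> A" "C \<inter> \<beta> n \<noteq> {}"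
        and C': "connected C'" "y \<in> C'" "C' \<subseteq> A" "C' \<inter> \<beta> n \<noteq> {}"
      using xy by metis
    have "connected (\<beta> n)"
      by (intro connected_continuous_image iterate_continuous conn)
    then have "connected (C \<union> \<beta> n \<union> C')"
      using C C' by (intro connected_Un) auto
    then show ?thesis
      using C C' n(2) by (intro exI[of _ "C \<union> \<beta> n \<union> C'"]) auto
  qed
  then have "connected_component A x y" if "x \<in> A" "y \<in> A" for x y
    using that by (simp add: connected_component_def)
  then show ?thesis
    by (simp add: connected_iff_connected_component)
qed

lemma connected_B_disc:
  assumes "connected (frontier U)"
  shows "connected (B_disc f D)"
proof (rule connected_if_reaches_spheres[OF assms eventually_beta_subset_B_disc])
  fix z R assume "z \<in> B_disc f D" "norm z \<le> R"
  then show "\<exists>C. connected C \<and> z \<in> C \<and> C \<subseteq> B_disc f D \<and> C \<inter> sphere 0 R \<noteq> {}"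
    using B_shift_reaches_sphere[OF julia_disc[OF D], of z 0 R] by (metis B_disc_eq_shift)
qed

text \<open>Although \<open>\<beta> n\<close> is controlled through \<open>D\<close>, its eventual
  inclusion in \<open>B_disc f D\<close> puts it in \<open>B_set f E\<close> for every other disc
  \<open>E\<close>.\<close>

lemma connected_B_set:
  assumes "connected (frontier U)" and E: "disc_meeting_julia f E"
  shows "connected (B_set f E)"
proof (rule connected_if_reaches_spheres[OF assms(1)])
  show "\<forall>\<^sub>F n in sequentially. \<beta> n \<subseteq> B_set f E"
    using eventually_beta_subset_B_disc
    by (rule eventually_mono) (use B_disc_subset_B_set[OF D julia_disc(2)[OF E]] in blast)
  fix z R assume "z \<in> B_set f E" "norm z \<le> R"
  then show "\<exists>C. connected C \<and> z \<in> C \<and> C \<subseteq> B_set f E \<and> C \<inter> sphere 0 R \<noteq> {}"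
    using B_set_reaches_sphere[OF julia_disc[OF E], of z R] by metis
qed

section \<open>Connectedness of the escaping set\<close>

text \<open>The iterates of \<open>V\<close> never cross \<open>\<beta> k\<close>. As the orbit of \<open>z\<close> eventually leaves the region
  surrounded by \<open>\<beta> k\<close>, so do the images of all of \<open>V\<close>.\<close>

lemma closure_subset_escaping:
  assumes z: "z \<in> escaping_set f" "z \<in> V" and V: "connected V" "V \<inter> B_set f D = {}"
  shows "closure V \<subseteq> escaping_set f"
proof
  fix y assume y: "y \<in> closure V"
  have "\<forall>\<^sub>F n in sequentially. M \<le> norm ((f ^^ n) y)" for M
  proof -
    obtain k where k: "ball 0 M \<subseteq> inside (\<beta> k)" "\<beta> k \<subseteq> B_disc f D"
      using eventually_conj[OF eventually_ball_subset_inside_beta[of M] eventually_beta_subset_B_disc]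
      by (auto dest: eventually_happens)
    obtain R where R: "\<beta> k \<subseteq> ball 0 R"
      using bounded_beta bounded_subset_ballD by blast
    have "\<forall>\<^sub>F n in sequentially. max R 1 \<le> norm ((f ^^ n) z)"
      using z(1) unfolding escaping_set_def mem_Collect_eq filterlim_at_infinity[OF order_refl]
      by (meson less_max_iff_disj zero_less_one)
    then show ?thesis
    proof eventually_elim
      case (elim n)
      have "(f ^^ n) ` V \<inter> \<beta> k = {}"
        using V(2) k(2) B_disc_subset_B_set[OF D julia_disc(2)[OF D]] B_set_backward_invariant by blast
      then have *: "connected_component (- \<beta> k) ((f ^^ n) z) ((f ^^ n) x)" if "x \<in> V" for x
        unfolding connected_component_def using that z(2) V(1)
        by (intro exI[of _ "(f ^^ n) ` V"]) (auto intro!: connected_continuous_image iterate_continuous)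
      have "(f ^^ n) z \<in> outside (\<beta> k)"
        using elim outside_subset_convex[OF convex_ball R] by auto
      then have "(f ^^ n) ` V \<subseteq> outside (\<beta> k)"
        using * outside_same_component by blast
      then have "(f ^^ n) ` V \<subseteq> - ball 0 M"
        using k(1) inside_Int_outside[of "\<beta> k"] by blast
      then have "(f ^^ n) ` closure V \<subseteq> - ball 0 M"
        by (intro image_closure_subset iterate_continuous) auto
      then show ?case
        using y by (auto simp: not_less)
    qed
  qed
  then show "y \<in> escaping_set f"
    by (simp add: escaping_set_def filterlim_at_infinity[of 0])
qed

text \<open>An escaping point in the closure of \<open>B\<close> can be adjoined to \<open>B\<close>
  directly. Any other is joined to \<open>B\<close> through the closure of its complementary
  component, which escapes and touches \<open>closure B\<close>.\<close>

lemma connected_escaping: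
  assumes "connected (frontier U)"
  shows "connected (escaping_set f)"
proof -
  define B where "B = B_set f D"
  have B: "connected B" "B \<subseteq> escaping_set f"
    unfolding B_def by (rule connected_B_set[OF assms D] B_set_subset_escaping[OF D])+
  obtain b where b: "b \<in> B"
    using frontier_nonempty frontier_U B_disc_subset_B_set[OF D julia_disc(2)[OF D]]
    by (auto simp: B_def)
  have "\<exists>T. connected T \<and> T \<subseteq> escaping_set f \<and> z \<in> T \<and> b \<in> T" if z: "z \<in> escaping_set f" for z
  proof (cases "z \<in> closure B")
    case True
    then have "connected (insert z B)"
      using closure_subset[of B] by (intro connected_intermediate_closure[OF B(1)]) auto
    then show ?thesis
      using B(2) b z by (intro exI[of _ "insert z B"]) auto
  next
    case False
    define V where "V = connected_component_set (- closure B) z"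
    have V: "connected V" "z \<in> V" "V \<subseteq> - closure B"
      using False connected_component_subset[of "- closure B" z]
      by (auto simp: V_def connected_component_refl)
    have sub: "closure V \<subseteq> escaping_set f"
      using V closure_subset[of B] by (intro closure_subset_escaping[OF z]) (auto simp: B_def)
    have "V \<noteq> {}" "V \<noteq> UNIV"
      using V b closure_subset[of B] by auto
    then obtain p where p: "p \<in> frontier V"
      using frontier_eq_empty by blast
    then have "p \<in> closure V"
      by (simp add: frontier_def)
    \<comment> \<open>The frontier of a component of \<open>- closure B\<close> lies in the frontier
      of the closed set \<open>closure B\<close>.\<close>
    have "p \<in> closure B"
      using p frontier_of_connected_component_subset[of "- closure B" z]
        frontier_subset_closed[of "closure B"] by (auto simp: V_def)
    then have "connected (insert p B)"
      using closure_subset[of B] by (intro connected_intermediate_closure[OF B(1)]) auto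
    then have "connected (closure V \<union> insert p B)"
      using V(1) \<open>p \<in> closure V\<close> by (intro connected_Un connected_imp_connected_closure) auto
    then show ?thesis
      using sub B(2) b V(2) \<open>p \<in> closure V\<close> closure_subset[of V]
      by (intro exI[of _ "closure V \<union> insert p B"]) auto
  qed
  then have "connected_component (escaping_set f) z b" if "z \<in> escaping_set f" for z
    using that by (simp add: connected_component_def)
  then show ?thesis
    unfolding connected_iff_connected_component
    by (meson connected_component_sym connected_component_trans)
qed

end

text \<open>The frontier of \<open>U\<close> may be disconnected. Filling the holes of \<open>U\<close> replaces it by the
  frontier of \<open>outside U\<close>, which is connected.\<close>

theorem theorem3:
  fixes f :: "complex \<Rightarrow> complex" and D U :: "complex set"
  assumes "transcendental_entire f"
    and "disc_meeting_julia f D"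
    and "plane_domain U" and "bounded U"
    and "frontier U \<subseteq> B_disc f D"
    and "U \<inter> julia_set f \<noteq> {}"
  shows "(sets_tend_to_infinity (\<lambda>n. (f ^^ n) ` frontier U) \<and>
          (\<forall>\<^sub>F n in sequentially.
             (f ^^ n) ` frontier U \<subseteq> B_disc f D \<and> surrounds ((f ^^ n) ` frontier U) 0)) \<and>
         (connected (B_disc f D) \<and>
          (\<forall>E. disc_meeting_julia f E \<longrightarrow> connected (B_set f E)) \<and>
          connected (escaping_set f))"
proof -
  have U: "open U" "connected U"
    using assms(3) by (auto simp: plane_domain_def)
  interpret U: surrounding_boundary f D U
    by unfold_locales (use assms U in auto)
  have comp: "outside U \<in> components (- U)"
    using unbounded_outside[OF assms(4)] connected_outside[OF assms(4)]
    by (auto simp: outside_in_components)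
  have fr: "frontier (fill U) = frontier (outside U)"
    by (simp add: fill_eq_outside)
  interpret V: surrounding_boundary f D "fill U"
  proof unfold_locales
    show "open (fill U)" "bounded (fill U)"
      using closed_outside_open[OF U(1) assms(4)] cobounded_outside[OF assms(4)]
      by (auto simp: fill_eq_outside)
    show "frontier (fill U) \<subseteq> B_disc f D"
      using assms(5) frontier_of_components_subset[OF comp] fr by auto
    show "fill U \<inter> julia_set f \<noteq> {}"
      using assms(6) subset_fill by blast
  qed (use assms in auto)
  \<comment> \<open>In the plane, each component of the complement of a connected set has connected
    frontier; here the component is \<open>outside U\<close>.\<close>
  have conn: "connected (frontier (fill U))"
    using connected_frontier_component_complement[OF U(2) comp] fr by simp
  have "\<forall>\<^sub>F n in sequentially. surrounds ((f ^^ n) ` frontier U) 0"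
    using U.eventually_ball_subset_inside_beta[of 1]
    by (rule eventually_mono) (auto simp: surrounds_def)
  \<comment> \<open>The claims on the images concern the original frontier and come from
    \<open>U\<close>; the connectedness claims come from \<open>V\<close>.\<close>
  then show ?thesis
    using U.beta_tendsto_infinity U.eventually_beta_subset_B_disc eventually_conj
      V.connected_B_disc[OF conn] V.connected_B_set[OF conn] V.connected_escaping[OF conn]
    by auto
qed

end
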